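(* For all integers $m\ge2$ and $k\in\mathbb N$, let $\zeta_{\mathcal P}(\{m\}^k):=\sum_{\ell(\lambda)=k}n_\lambda^{-m}$, the sum over all integer partitions $\lambda$ with exactly $k$ parts, $n_\lambda$ being the product of the parts. Then \[\zeta_{\mathcal P}(\{m\}^k)=\pi^{mk}[z^{mk}]\prod_{r=0}^{m-1}\Gamma\!\left(1-\frac{z}{\pi}e(r/m)\right)=\pi^{mk}[z^{mk}]\exp\!\left(\sum_{j\ge1}\frac{\zeta(mj)}{j}\left(\frac z\pi\right)^{mj}\right),\] where $[z^N]g$ denotes the coefficient of $z^N$ in the power series expansion of $g$ about $z=0$, $\Gamma$ is Euler's gamma function, $\zeta$ is the Riemann zeta function, and $e(x):=e^{2\pi ix}$. *)

theory Defs
  imports "HOL-Complex_Analysis.Complex_Analysis" "HOL-Library.Multiset"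
begin

text \<open>
  An integer partition is the multiset of its (positive) parts; the number of parts is
  the size of the multiset.  The empty partition is the only partition with no parts.
\<close>

definition integer_partition :: "nat multiset \<Rightarrow> bool" where
  "integer_partition P \<longleftrightarrow> (\<forall>i\<in>#P. i > 0)"

definition partitions_with_parts :: "nat \<Rightarrow> nat multiset set" where
  "partitions_with_parts k = {P. integer_partition P \<and> size P = k}"

definition partition_zeta_term :: "nat \<Rightarrow> nat multiset \<Rightarrow> real" where
  "partition_zeta_term m P = 1 / real (\<Prod>\<^sub># P) ^ m"

definition partition_zeta :: "nat \<Rightarrow> nat \<Rightarrow> real" where
  "partition_zeta m k = (\<Sum>\<^sub>\<infinity>P\<in>partitions_with_parts k. partition_zeta_term m P)"

text \<open>
  The Riemann zeta function, given by its Dirichlet series; the definition is meaningful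
  only for \<open>Re s > 1\<close>, no analytic continuation is made.
\<close>

definition riemann_zeta :: "complex \<Rightarrow> complex" where
  "riemann_zeta s = (\<Sum>n. 1 / of_nat (Suc n) powr s)"

definition unit_exp :: "real \<Rightarrow> complex" where
  "unit_exp x = exp (2 * of_real pi * \<i> * of_real x)"

definition gamma_product :: "nat \<Rightarrow> complex \<Rightarrow> complex" where
  "gamma_product m z = (\<Prod>r<m. Gamma (1 - z / of_real pi * unit_exp (real r / real m)))"

text \<open>The \<open>j\<close>-th term below, \<open>j \<ge> 0\<close>, is the term of index \<open>Suc j\<close> of the series over \<open>j \<ge> 1\<close>.\<close>

definition zeta_exponent_term :: "nat \<Rightarrow> complex \<Rightarrow> nat \<Rightarrow> complex" where
  "zeta_exponent_term m z j =
     riemann_zeta (of_nat (m * Suc j)) / of_nat (Suc j) * (z / of_real pi) ^ (m * Suc j)"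

definition zeta_exponential :: "nat \<Rightarrow> complex \<Rightarrow> complex" where
  "zeta_exponential m z = exp (\<Sum>j. zeta_exponent_term m z j)"

text \<open>
  The coefficient of \<open>z ^ N\<close> in the Taylor series of \<open>g\<close> about 0; it is the intended notion
  only if \<open>g\<close> is analytic at 0.
\<close>

definition taylor_coeff :: "nat \<Rightarrow> (complex \<Rightarrow> complex) \<Rightarrow> complex" where
  "taylor_coeff N g = fps_nth (fps_expansion g 0) N"

end

theory Submission
  imports Defs "HOL-Computational_Algebra.Fundamental_Theorem_Algebra"
begin

text \<open>
  Put \<open>u = z / \<pi>\<close>. The product of \<open>1 / (1 - (u / n) ^ m)\<close> over \<open>1 \<le> n \<le> N\<close> generates, in powers
  of \<open>u ^ m\<close>, the sums of \<open>partition_zeta_term m\<close> over the partitions with parts at most \<open>N\<close>.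
  As \<open>N\<close> grows, Gauss's product for \<open>Gamma\<close> and the factorisation of \<open>1 - (u / n) ^ m\<close> over the
  roots of unity identify the limit of these products with \<open>gamma_product m z\<close>, and the logarithm
  series identifies it with \<open>zeta_exponential m z\<close>. Tannery's theorem lets the limit pass into
  the power series, so no locally uniform convergence is needed.
\<close>

section \<open>Complete homogeneous symmetric sums and their generating function\<close>

text \<open>Used below with \<open>x n = 1 / n ^ m\<close> and \<open>A = {1..N}\<close>: a multiset
  over \<open>A\<close> is then a partition with parts at most \<open>N\<close>.\<close>

definition complete_homogeneous :: "('a \<Rightarrow> real) \<Rightarrow> 'a set \<Rightarrow> nat \<Rightarrow> real" where
  "complete_homogeneous x A k = (\<Sum>P\<in>multisets_of_size A k. \<Prod>i\<in>#P. x i)"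

lemma complete_homogeneous_empty: "complete_homogeneous x {} k = (if k = 0 then 1 else 0)"
  by (simp add: complete_homogeneous_def)

text \<open>Multisets over \<open>insert a A\<close> are sorted by the multiplicity of
  \<open>a\<close>. The result is written as a Cauchy product with the geometric series of
  \<open>x a\<close>.\<close>

lemma complete_homogeneous_insert:
  assumes "finite A" "a \<notin> A"
  shows "complete_homogeneous x (insert a A) k = (\<Sum>i\<le>k. complete_homogeneous x A i * x a ^ (k - i))"
proof -
  have "complete_homogeneous x (insert a A) k =
      (\<Sum>(m, P)\<in>(SIGMA m:{0..k}. multisets_of_size A (k - m)). \<Prod>i\<in>#P + replicate_mset m a. x i)"
    unfolding complete_homogeneous_def
    by (subst sum.reindex_bij_betw[OF bij_betw_multisets_of_size_insert[OF assms(2)], symmetric])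
       (simp add: case_prod_unfold)
  also have "\<dots> = (\<Sum>m=0..k. \<Sum>P\<in>multisets_of_size A (k - m). (\<Prod>i\<in>#P. x i) * x a ^ m)"
    using assms by (subst sum.Sigma) (auto simp: finite_multisets_of_size)
  also have "\<dots> = (\<Sum>m=0..k. complete_homogeneous x A (k - m) * x a ^ m)"
    by (simp add: complete_homogeneous_def sum_distrib_right)
  also have "\<dots> = (\<Sum>i\<le>k. complete_homogeneous x A i * x a ^ (k - i))"
    by (rule sum.reindex_bij_witness[of _ "\<lambda>i. k - i" "\<lambda>i. k - i"]) auto
  finally show ?thesis .
qed

lemma complete_homogeneous_nonneg:
  assumes "\<And>i. i \<in> A \<Longrightarrow> x i \<ge> 0"
  shows "complete_homogeneous x A k \<ge> 0"
  unfolding complete_homogeneous_def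
proof (rule sum_nonneg)
  fix P assume "P \<in> multisets_of_size A k"
  hence "set_mset P \<subseteq> A"
    by (rule multisets_of_size_subset)
  thus "0 \<le> (\<Prod>i\<in>#P. x i)"
    using assms by (induction P) auto
qed

text \<open>Each new index multiplies the series by a geometric series. The variable
  \<open>w\<close> stays arbitrary in the induction because the hypothesis is used at
  \<open>norm w\<close> as well as at \<open>w\<close>.\<close>

lemma complete_homogeneous_generating_function:
  fixes w :: complex
  assumes "finite A" "\<And>i. i \<in> A \<Longrightarrow> 0 \<le> x i \<and> x i \<le> 1" "norm w < 1"
  shows "(\<lambda>k. of_real (complete_homogeneous x A k) * w ^ k) sums (\<Prod>i\<in>A. 1 / (1 - of_real (x i) * w))"
  using assms
proof (induction A arbitrary: w rule: finite_induct)
  case empty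
  have "(\<lambda>k. of_real (complete_homogeneous x {} k) * w ^ k) = (\<lambda>k. if k = 0 then 1 else 0)"
    by (auto simp: complete_homogeneous_empty)
  thus ?case
    using sums_single[of 0 "\<lambda>_. 1 :: complex"] by simp
next
  case (insert a A)
  define f where "f = (\<lambda>k. of_real (complete_homogeneous x A k) * w ^ k)"
  define g where "g = (\<lambda>k. (of_real (x a) * w) ^ k)"
  have xa: "0 \<le> x a" "x a \<le> 1"
    using insert.prems by auto
  have f: "f sums (\<Prod>i\<in>A. 1 / (1 - of_real (x i) * w))"
    unfolding f_def using insert by auto
  \<comment> \<open>As the coefficients are nonnegative, convergence at the real point
    \<open>norm w\<close> is absolute convergence at \<open>w\<close>, which the Cauchy product
    requires.\<close>
  have "(\<lambda>k. of_real (complete_homogeneous x A k) * of_real (norm w) ^ k :: complex) sums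
          (\<Prod>i\<in>A. 1 / (1 - of_real (x i) * of_real (norm w)))"
    using insert.prems by (intro insert.IH) auto
  hence "summable (\<lambda>k. of_real (complete_homogeneous x A k * norm w ^ k) :: complex)"
    by (simp add: sums_iff)
  hence "summable (\<lambda>k. complete_homogeneous x A k * norm w ^ k)"
    by (subst (asm) summable_of_real_iff)
  moreover have "norm (f k) = complete_homogeneous x A k * norm w ^ k" for k
    using complete_homogeneous_nonneg[of A x k] insert.prems by (auto simp: f_def norm_mult norm_power)
  ultimately have norm_f: "summable (\<lambda>k. norm (f k))"
    by simp
  have "norm (of_real (x a) * w) = x a * norm w"
    using xa by (simp add: norm_mult)
  also have "\<dots> \<le> 1 * norm w"
    using xa by (intro mult_right_mono) auto
  finally have lt: "norm (of_real (x a) * w) < 1"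
    using insert.prems by simp
  have g: "g sums (1 / (1 - of_real (x a) * w))"
    unfolding g_def by (rule geometric_sums[OF lt])
  have norm_g: "summable (\<lambda>k. norm (g k))"
    unfolding g_def norm_power by (rule summable_geometric) (use lt in simp)
  have "(\<lambda>k. \<Sum>i\<le>k. f i * g (k - i)) sums ((\<Sum>k. f k) * (\<Sum>k. g k))"
    by (rule Cauchy_product_sums[OF norm_f norm_g])
  moreover have "(\<Sum>i\<le>k. f i * g (k - i)) = of_real (complete_homogeneous x (insert a A) k) * w ^ k" for k
  proof -
    have "(\<Sum>i\<le>k. f i * g (k - i)) =
        (\<Sum>i\<le>k. of_real (complete_homogeneous x A i * x a ^ (k - i)) * w ^ k)"
      by (rule sum.cong)
         (auto simp: f_def g_def power_mult_distrib mult_ac simp flip: power_add)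
    thus ?thesis
      using insert.hyps by (simp add: complete_homogeneous_insert sum_distrib_right)
  qed
  moreover have "(\<Sum>k. f k) * (\<Sum>k. g k) = (\<Prod>i\<in>insert a A. 1 / (1 - of_real (x i) * w))"
    using insert.hyps f g by (simp add: sums_iff mult_ac)
  ultimately show ?case
    by simp
qed

section \<open>Roots of unity and the factorisation of \<open>1 - v ^ m\<close>\<close>

lemma unit_exp_eq_cis: "unit_exp x = cis (2 * pi * x)"
  by (simp add: unit_exp_def cis_conv_exp mult_ac)

lemma bij_betw_unit_exp_roots_unity:
  assumes "m > 0"
  shows "bij_betw (\<lambda>r. unit_exp (real r / real m)) {..<m} {z. z ^ m = 1}"
  using Complex.bij_betw_roots_unity[OF assms] by (simp add: unit_exp_eq_cis)

lemma sum_unit_exp_eq_0: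
  assumes "m \<ge> 2"
  shows "(\<Sum>r<m. unit_exp (real r / real m)) = 0"
  using sum.reindex_bij_betw[OF bij_betw_unit_exp_roots_unity, of m "\<lambda>z. z"]
    sum_roots_unity[of m] assms by simp

text \<open>For nonzero \<open>v\<close>, the factorisation of \<open>X ^ m - 1\<close> into linear
  factors is evaluated at \<open>1 / v\<close> and scaled by \<open>v ^ m\<close>.\<close>

lemma prod_one_minus_unit_exp:
  fixes v :: complex
  assumes "m > 0"
  shows "(\<Prod>r<m. 1 - v * unit_exp (real r / real m)) = 1 - v ^ m"
proof (cases "v = 0")
  case False
  define p :: "complex poly" where "p = monom 1 m - 1"
  have poly_p: "poly p z = z ^ m - 1" for z
    by (simp add: p_def poly_monom)
  have "degree p = m"
    unfolding p_def diff_conv_add_uminus using assms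
    by (subst degree_add_eq_left) (auto simp: degree_monom_eq)
  hence lc: "lead_coeff p = 1"
    using assms by (simp add: p_def)
  \<comment> \<open>A common root of \<open>p\<close> and its derivative would have to be 0, and 0
    is not a root of \<open>p\<close>.\<close>
  have "rsquarefree p"
    unfolding rsquarefree_roots using assms
    by (auto simp: poly_p p_def pderiv_diff pderiv_monom poly_monom power_0_left)
  from complex_poly_decompose_rsquarefree[OF this]
  have p: "(\<Prod>z | z ^ m = 1. [:-z, 1:]) = p"
    by (simp add: lc poly_p)
  have "(\<Prod>r<m. 1 - v * unit_exp (real r / real m)) = (\<Prod>z | z ^ m = 1. 1 - v * z)"
    by (rule prod.reindex_bij_betw[OF bij_betw_unit_exp_roots_unity[OF assms]])
  also have "\<dots> = (\<Prod>z | z ^ m = 1. v * poly [:-z, 1:] (1 / v))"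
    using False by (simp add: right_diff_distrib)
  also have "\<dots> = v ^ m * poly (\<Prod>z | z ^ m = 1. [:-z, 1:]) (1 / v)"
    using assms by (simp only: prod.distrib prod_constant card_roots_unity_eq poly_prod)
  also have "\<dots> = 1 - v ^ m"
    using False by (simp add: p poly_p field_simps)
  finally show ?thesis .
qed (use assms in simp)

section \<open>Gauss's formula and the limit of the Euler products\<close>

text \<open>One factor \<open>n\<close> of the exponential completes \<open>fact (n - 1)\<close> to
  \<open>fact n\<close>, which is then divided factor by factor by the Pochhammer symbol. If
  \<open>a\<close> is one of the integers from 1 to \<open>n\<close>, both sides are 0 by division
  by zero.\<close>

lemma Gamma_series'_one_minus:
  fixes a :: complex
  assumes "n > 0"
  shows "Gamma_series' (1 - a) n =
    exp (- a * of_real (ln (real n))) * (\<Prod>j=1..n. 1 / (1 - a / of_nat j))"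
proof -
  have "exp ((1 - a) * of_real (ln (real n))) =
      exp (of_real (ln (real n))) * exp (- a * of_real (ln (real n)))"
    by (simp add: algebra_simps flip: exp_add)
  also have "exp (of_real (ln (real n)) :: complex) = of_nat n"
    using assms by (subst exp_of_real) simp
  finally have "Gamma_series' (1 - a) n =
      exp (- a * of_real (ln (real n))) * (fact (n - 1) * of_nat n / pochhammer (1 - a) n)"
    by (simp add: Gamma_series'_def)
  also have "fact (n - 1) * of_nat n = (fact n :: complex)"
    using assms by (simp add: fact_reduce)
  also have "fact n / pochhammer (1 - a) n = (\<Prod>j=1..n. 1 / (1 - a / of_nat j))"
  proof -
    have "fact n / pochhammer (1 - a) n = (\<Prod>j<n. of_nat (Suc j) / (1 - a + of_nat j))"
      by (simp add: fact_prod_Suc pochhammer_prod prod_dividef lessThan_atLeast0)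
    also have "\<dots> = (\<Prod>j<n. 1 / (1 - a / of_nat (Suc j)))"
    proof (rule prod.cong)
      fix j
      have "1 - a / of_nat (Suc j) = (1 - a + of_nat j) / of_nat (Suc j)"
        by (simp add: field_simps del: of_nat_Suc) (simp add: algebra_simps)
      thus "of_nat (Suc j) / (1 - a + of_nat j) = 1 / (1 - a / of_nat (Suc j))"
        by simp
    qed simp
    finally show ?thesis
      by (simp add: prod.atLeast1_atMost_eq)
  qed
  finally show ?thesis .
qed

text \<open>The factors \<open>n powr (- u * \<omega>)\<close> of Gauss's formula cancel, as the roots of unity sum to 0.\<close>

lemma gamma_product_LIMSEQ:
  assumes "m \<ge> 2"
  shows "(\<lambda>N. \<Prod>n=1..N. 1 / (1 - (z / of_real pi / of_nat n) ^ m)) \<longlonglongrightarrow> gamma_product m z"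
proof -
  define u where "u = z / of_real pi"
  define e where "e = (\<lambda>r. unit_exp (real r / real m))"
  \<comment> \<open>This covers every \<open>z\<close>: at its poles \<open>Gamma\<close> takes the
    value 0, and the limit formula still holds there.\<close>
  have "(\<lambda>N. \<Prod>r<m. Gamma_series' (1 - u * e r) N) \<longlonglongrightarrow> (\<Prod>r<m. Gamma (1 - u * e r))"
    by (intro tendsto_prod Gamma_series'_LIMSEQ)
  also have "(\<Prod>r<m. Gamma (1 - u * e r)) = gamma_product m z"
    by (simp add: gamma_product_def u_def e_def)
  finally show ?thesis
  proof (rule Lim_transform_eventually)
    show "\<forall>\<^sub>F N in sequentially. (\<Prod>r<m. Gamma_series' (1 - u * e r) N) =
        (\<Prod>n=1..N. 1 / (1 - (z / of_real pi / of_nat n) ^ m))"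
      using eventually_gt_at_top[of 0]
    proof eventually_elim
      case (elim N)
      define L :: complex where "L = of_real (ln (real N))"
      have "(\<Prod>r<m. Gamma_series' (1 - u * e r) N) =
          (\<Prod>r<m. exp (- (u * e r) * L)) * (\<Prod>r<m. \<Prod>n=1..N. 1 / (1 - u * e r / of_nat n))"
        using elim by (simp add: Gamma_series'_one_minus prod.distrib L_def)
      also have "(\<Prod>r<m. exp (- (u * e r) * L)) = exp (- (u * L) * (\<Sum>r<m. e r))"
        by (simp add: exp_sum sum_distrib_left mult_ac)
      also have "\<dots> = 1"
        using assms by (simp add: e_def sum_unit_exp_eq_0)
      also have "(\<Prod>r<m. \<Prod>n=1..N. 1 / (1 - u * e r / of_nat n)) =
          (\<Prod>n=1..N. 1 / (\<Prod>r<m. 1 - u / of_nat n * e r))"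
        by (subst prod.swap) (simp add: prod_dividef)
      also have "\<dots> = (\<Prod>n=1..N. 1 / (1 - (u / of_nat n) ^ m))"
        unfolding e_def using assms by (subst prod_one_minus_unit_exp) auto
      finally show ?case
        by (simp add: u_def)
    qed
  qed
qed

section \<open>Truncated partition sums, their bounds and their limit\<close>

lemma partition_zeta_term_nonneg: "partition_zeta_term m P \<ge> 0"
  by (simp add: partition_zeta_term_def)

lemma complete_homogeneous_eq_sum_partition_zeta_term:
  "complete_homogeneous (\<lambda>n. 1 / real n ^ m) A k = (\<Sum>P\<in>multisets_of_size A k. partition_zeta_term m P)"
proof -
  have "(\<Prod>n\<in>#P. 1 / real n ^ m) = 1 / real (\<Prod>\<^sub># P) ^ m" for P
    by (induction P) (auto simp: power_mult_distrib)
  thus ?thesis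
    by (simp add: complete_homogeneous_def partition_zeta_term_def)
qed

lemma multisets_of_size_subset_partitions:
  "multisets_of_size {1..N} k \<subseteq> partitions_with_parts k"
  by (auto simp: multisets_of_size_def partitions_with_parts_def integer_partition_def)

lemma finite_partitions_bounded:
  assumes "finite F" "F \<subseteq> partitions_with_parts k"
  obtains N where "F \<subseteq> multisets_of_size {1..N} k"
proof
  \<comment> \<open>The bound is the largest part occurring in \<open>F\<close>. If there is no part
    at all, \<open>Max\<close> is unspecified, but the inclusion does not depend on its
    value.\<close>
  show "F \<subseteq> multisets_of_size {1..Max (\<Union>P\<in>F. set_mset P)} k"
  proof
    fix P assume P: "P \<in> F"
    have "i \<le> Max (\<Union>P\<in>F. set_mset P)" if "i \<in># P" for i
      using P that assms(1) by (intro Max_ge) auto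
    thus "P \<in> multisets_of_size {1..Max (\<Union>P\<in>F. set_mset P)} k"
      using P assms(2)
      by (auto simp: multisets_of_size_def partitions_with_parts_def integer_partition_def Suc_le_eq)
  qed
qed

text \<open>The truncations are eventually above every finite set of partitions, so an unordered
  infinite sum becomes a limit of a sequence.\<close>

lemma filterlim_multisets_of_size:
  "filterlim (\<lambda>N. multisets_of_size {1..N} k) (finite_subsets_at_top (partitions_with_parts k)) sequentially"
  unfolding filterlim_finite_subsets_at_top
proof safe
  fix F assume F: "finite F" "F \<subseteq> partitions_with_parts k"
  then obtain N where N: "F \<subseteq> multisets_of_size {1..N} k"
    by (rule finite_partitions_bounded)
  have "F \<subseteq> multisets_of_size {1..M} k" if "M \<ge> N" for M
    using N multisets_of_size_mono[of "{1..N}" "{1..M}" k] that by fastforce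
  thus "\<forall>\<^sub>F M in sequentially. finite (multisets_of_size {1..M} k) \<and>
      F \<subseteq> multisets_of_size {1..M} k \<and> multisets_of_size {1..M} k \<subseteq> partitions_with_parts k"
    unfolding eventually_sequentially
    using multisets_of_size_subset_partitions by (intro exI[of _ N]) blast
qed

text \<open>
  At a real point \<open>w\<close> in \<open>{0..<1}\<close> all terms are nonnegative, so the convergence of the Euler
  products bounds every truncated partition sum.
\<close>

lemma complete_homogeneous_bounded:
  assumes "m \<ge> 2" "0 \<le> w" "w < 1"
  obtains B where "\<And>N K. (\<Sum>k<K. complete_homogeneous (\<lambda>n. 1 / real n ^ m) {1..N} k * w ^ k) \<le> B"
proof -
  \<comment> \<open>The root makes the Gamma limit at \<open>z = u * pi\<close> the one belonging to
    the generating function at \<open>w\<close>.\<close>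
  define u where "u = root m w"
  have u: "u ^ m = w"
    using assms by (simp add: u_def)
  define Q where "Q = (\<lambda>N. \<Prod>n=1..N. 1 / (1 - (of_real (u * pi) / of_real pi / of_nat n :: complex) ^ m))"
  have "Q \<longlonglongrightarrow> gamma_product m (of_real (u * pi))"
    unfolding Q_def by (rule gamma_product_LIMSEQ[OF assms(1)])
  hence "Bseq Q"
    using convergent_def convergent_imp_Bseq by blast
  then obtain B where B: "\<And>N. norm (Q N) \<le> B"
    unfolding Bseq_def by blast
  show ?thesis
  proof
    fix N K
    define h where "h = complete_homogeneous (\<lambda>n. 1 / real n ^ m) {1..N}"
    have "Q N = (\<Prod>n=1..N. 1 / (1 - of_real (1 / real n ^ m) * of_real w))"
      by (simp add: Q_def power_divide flip: u)
    moreover have "(\<lambda>k. of_real (h k) * (of_real w :: complex) ^ k) sums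
        (\<Prod>n=1..N. 1 / (1 - of_real (1 / real n ^ m) * of_real w))"
      unfolding h_def using assms by (intro complete_homogeneous_generating_function) auto
    ultimately have sums: "(\<lambda>k. of_real (h k * w ^ k)) sums Q N"
      by simp
    hence summable: "summable (\<lambda>k. h k * w ^ k)"
      by (metis sums_summable summable_of_real_iff)
    have nonneg: "h k * w ^ k \<ge> 0" for k
      using assms by (simp add: h_def complete_homogeneous_nonneg)
    have "(\<Sum>k<K. h k * w ^ k) \<le> (\<Sum>k. h k * w ^ k)"
      using summable nonneg by (intro sum_le_suminf) auto
    also have "\<dots> \<le> norm (Q N)"
    proof -
      have "Q N = of_real (\<Sum>k. h k * w ^ k)"
        using sums sums_of_real[OF summable_sums[OF summable]] sums_unique2 by blast
      thus ?thesis
        by simp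
    qed
    also have "\<dots> \<le> B"
      by (rule B)
    finally show "(\<Sum>k<K. complete_homogeneous (\<lambda>n. 1 / real n ^ m) {1..N} k * w ^ k) \<le> B"
      by (simp add: h_def)
  qed
qed

text \<open>One term of a bounded nonnegative sum is bounded. At \<open>w = 1/2\<close> this gives
  the bound \<open>B * 2 ^ k\<close> for all finite partial sums.\<close>

lemma summable_on_partition_zeta_term:
  assumes "m \<ge> 2"
  shows "partition_zeta_term m summable_on partitions_with_parts k"
proof -
  define h where "h = (\<lambda>N. complete_homogeneous (\<lambda>n. 1 / real n ^ m) {1..N})"
  obtain B where B: "\<And>N K. (\<Sum>j<K. h N j * (1/2) ^ j) \<le> B"
    using complete_homogeneous_bounded[OF assms, of "1/2"] unfolding h_def by auto
  have "sum (partition_zeta_term m) F \<le> B * 2 ^ k"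
    if F: "finite F" "F \<subseteq> partitions_with_parts k" for F
  proof -
    obtain N where "F \<subseteq> multisets_of_size {1..N} k"
      using F by (rule finite_partitions_bounded)
    hence "sum (partition_zeta_term m) F \<le> h N k"
      unfolding h_def complete_homogeneous_eq_sum_partition_zeta_term
      by (intro sum_mono2) (auto simp: finite_multisets_of_size partition_zeta_term_nonneg)
    moreover have "h N k * (1/2) ^ k \<le> (\<Sum>j<Suc k. h N j * (1/2) ^ j)"
      by (rule member_le_sum) (auto simp: h_def complete_homogeneous_nonneg)
    ultimately show ?thesis
      using B[of N "Suc k"] by (simp add: field_simps)
  qed
  thus ?thesis
    by (intro nonneg_bdd_above_summable_on)
       (auto simp: partition_zeta_term_nonneg bdd_above_def)
qed

lemma complete_homogeneous_LIMSEQ_partition_zeta: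
  assumes "m \<ge> 2"
  shows "(\<lambda>N. complete_homogeneous (\<lambda>n. 1 / real n ^ m) {1..N} k) \<longlonglongrightarrow> partition_zeta m k"
  unfolding complete_homogeneous_eq_sum_partition_zeta_term partition_zeta_def
  by (rule filterlim_compose[OF infsum_tendsto filterlim_multisets_of_size])
     (rule summable_on_partition_zeta_term[OF assms])

lemma complete_homogeneous_le_partition_zeta:
  assumes "m \<ge> 2"
  shows "complete_homogeneous (\<lambda>n. 1 / real n ^ m) {1..N} k \<le> partition_zeta m k"
  unfolding complete_homogeneous_eq_sum_partition_zeta_term partition_zeta_def
  using summable_on_partition_zeta_term[OF assms] multisets_of_size_subset_partitions
  by (intro finite_sum_le_infsum) (auto simp: finite_multisets_of_size partition_zeta_term_nonneg)

text \<open>The bound \<open>B\<close> is uniform in \<open>N\<close> and \<open>K\<close>. Letting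
  \<open>N\<close> tend to infinity with \<open>K\<close> fixed therefore bounds every partial sum
  of a nonnegative series.\<close>

lemma summable_partition_zeta_power:
  assumes "m \<ge> 2" "0 \<le> w" "w < 1"
  shows "summable (\<lambda>k. partition_zeta m k * w ^ k)"
proof -
  obtain B where B: "\<And>N K. (\<Sum>k<K. complete_homogeneous (\<lambda>n. 1 / real n ^ m) {1..N} k * w ^ k) \<le> B"
    using complete_homogeneous_bounded[OF assms] by blast
  have "(\<Sum>k<K. partition_zeta m k * w ^ k) \<le> B" for K
  proof (rule LIMSEQ_le_const2)
    show "(\<lambda>N. \<Sum>k<K. complete_homogeneous (\<lambda>n. 1 / real n ^ m) {1..N} k * w ^ k) \<longlonglongrightarrow>
        (\<Sum>k<K. partition_zeta m k * w ^ k)"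
      by (intro tendsto_intros complete_homogeneous_LIMSEQ_partition_zeta assms)
  qed (use B in blast)
  moreover have "partition_zeta m k \<ge> 0" for k
    unfolding partition_zeta_def by (intro infsum_nonneg partition_zeta_term_nonneg)
  ultimately show ?thesis
    using assms
    by (intro bounded_imp_summable[where B = B])
       (auto simp: lessThan_Suc_atMost[symmetric] simp del: sum.lessThan_Suc)
qed

section \<open>The power series of the Gamma product and its Taylor coefficients\<close>

lemma gamma_product_sums:
  fixes z :: complex
  assumes "m \<ge> 2" "norm z < pi"
  shows "(\<lambda>k. of_real (partition_zeta m k) * ((z / of_real pi) ^ m) ^ k) sums gamma_product m z"
proof -
  define w where "w = (z / of_real pi) ^ m"
  define h where "h = (\<lambda>N. complete_homogeneous (\<lambda>n. 1 / real n ^ m) {1..N})"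
  have "norm (z / of_real pi) < 1"
    using assms by (simp add: norm_divide)
  hence w: "norm w < 1"
    unfolding w_def norm_power using assms by (simp add: power_less_one_iff)
  have h_nonneg: "h N k \<ge> 0" for N k
    by (simp add: h_def complete_homogeneous_nonneg)
  have M: "summable (\<lambda>k. partition_zeta m k * norm w ^ k)"
    using assms w by (intro summable_partition_zeta_power) auto
  have T: "(\<forall>\<^sub>F N in sequentially. summable (\<lambda>k. norm (of_real (h N k) * w ^ k))) \<and>
      summable (\<lambda>k. norm (of_real (partition_zeta m k) * w ^ k)) \<and>
      (\<lambda>N. \<Sum>k. of_real (h N k) * w ^ k) \<longlonglongrightarrow> (\<Sum>k. of_real (partition_zeta m k) * w ^ k)"
  \<comment> \<open>The majorant is the limit series itself at \<open>norm w\<close>, since the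
    truncated sums never exceed \<open>partition_zeta m k\<close>.\<close>
  proof (rule tannerys_theorem[OF _ _ M])
    show "(\<lambda>N. of_real (h N k) * w ^ k) \<longlonglongrightarrow> of_real (partition_zeta m k) * w ^ k" for k
      unfolding h_def by (intro tendsto_intros complete_homogeneous_LIMSEQ_partition_zeta assms)
    have "norm (of_real (h N k) * w ^ k) \<le> partition_zeta m k * norm w ^ k" for N k
      using complete_homogeneous_le_partition_zeta[OF assms(1), of N k] h_nonneg[of N k]
      by (auto simp: norm_mult norm_power h_def intro!: mult_right_mono)
    thus "\<forall>\<^sub>F (k, N) in sequentially \<times>\<^sub>F sequentially.
        norm (of_real (h N k) * w ^ k) \<le> partition_zeta m k * norm w ^ k"
      by (intro always_eventually) auto
  qed simp
  have "(\<lambda>N. \<Sum>k. of_real (h N k) * w ^ k) = (\<lambda>N. \<Prod>n=1..N. 1 / (1 - (z / of_real pi / of_nat n) ^ m))"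
  proof
    fix N
    have "(\<lambda>k. of_real (h N k) * w ^ k) sums (\<Prod>n=1..N. 1 / (1 - of_real (1 / real n ^ m) * w))"
      unfolding h_def using w by (intro complete_homogeneous_generating_function) auto
    moreover have "of_real (1 / real n ^ m) * w = (z / of_real pi / of_nat n) ^ m" for n
      by (simp add: w_def power_divide power_mult_distrib)
    ultimately show "(\<Sum>k. of_real (h N k) * w ^ k) =
        (\<Prod>n=1..N. 1 / (1 - (z / of_real pi / of_nat n) ^ m))"
      by (simp only: sums_iff)
  qed
  with gamma_product_LIMSEQ[OF assms(1), of z]
  have "(\<lambda>N. \<Sum>k. of_real (h N k) * w ^ k) \<longlonglongrightarrow> gamma_product m z"
    by (simp only:)
  with T have "(\<Sum>k. of_real (partition_zeta m k) * w ^ k) = gamma_product m z"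
    by (intro LIMSEQ_unique[where X = "\<lambda>N. \<Sum>k. of_real (h N k) * w ^ k"]) simp_all
  moreover have "summable (\<lambda>k. of_real (partition_zeta m k) * w ^ k)"
    using T by (intro summable_norm_cancel[where f = "\<lambda>k. of_real (partition_zeta m k) * w ^ k"]) simp
  ultimately show ?thesis
    by (simp only: sums_iff w_def)
qed

lemma sums_imp_has_fps_expansion:
  fixes f :: "complex \<Rightarrow> complex"
  assumes "r > 0" "\<And>z. norm z < r \<Longrightarrow> (\<lambda>n. c n * z ^ n) sums f z"
  shows "f has_fps_expansion Abs_fps c"
  unfolding has_fps_expansion_def
proof
  \<comment> \<open>Convergence at the single interior point \<open>r / 2\<close> already forces a
    positive radius of convergence.\<close>
  have "summable (\<lambda>n. c n * of_real (r / 2) ^ n)"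
    using assms by (intro sums_summable[OF assms(2)]) auto
  hence "ereal (norm (of_real (r / 2) :: complex)) \<le> conv_radius c"
    by (rule conv_radius_geI)
  thus "0 < fps_conv_radius (Abs_fps c)"
    using assms(1) by (auto simp: fps_conv_radius_def intro: less_le_trans[rotated])
  have "\<forall>\<^sub>F z in nhds 0. z \<in> ball (0 :: complex) r"
    using assms(1) by (intro eventually_nhds_in_open) auto
  thus "\<forall>\<^sub>F z in nhds 0. eval_fps (Abs_fps c) z = f z"
    by eventually_elim (use assms(2) in \<open>auto simp: eval_fps_def sums_iff\<close>)
qed

lemma taylor_coeff_has_fps_expansion:
  assumes "f has_fps_expansion F"
  shows "taylor_coeff n f = fps_nth F n"
  using assms fps_expansion_unique_complex analytic_at_imp_has_fps_expansion_0
    has_fps_expansion_imp_analytic_0 unfolding taylor_coeff_def by metis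

text \<open>The series in powers of \<open>(z / pi) ^ m\<close> is spread out to a series in
  \<open>z\<close> by filling in zero coefficients at the exponents not divisible by
  \<open>m\<close>.\<close>

lemma gamma_product_has_fps_expansion:
  assumes "m \<ge> 2"
  shows "gamma_product m has_fps_expansion Abs_fps
    (\<lambda>n. if m dvd n then of_real (partition_zeta m (n div m)) / of_real pi ^ n else 0)"
proof (rule sums_imp_has_fps_expansion)
  fix z :: complex assume z: "norm z < pi"
  define g where "g = (\<lambda>n. (if m dvd n then of_real (partition_zeta m (n div m)) / of_real pi ^ n else 0) * z ^ n)"
  have "strict_mono (\<lambda>k. m * k)"
    using assms by (auto intro!: strict_monoI)
  moreover have "g n = 0" if "n \<notin> range (\<lambda>k. m * k)" for n
    using that by (auto simp: g_def dvd_def)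
  moreover have "(\<lambda>k. g (m * k)) sums gamma_product m z"
  proof -
    have "g (m * k) = of_real (partition_zeta m k) * ((z / of_real pi) ^ m) ^ k" for k
      using assms by (simp add: g_def power_divide flip: power_mult)
    thus ?thesis
      using gamma_product_sums[OF assms z] by simp
  qed
  ultimately show "g sums gamma_product m z"
    using sums_mono_reindex by blast
qed simp

section \<open>The exponential of the zeta series\<close>

lemma riemann_zeta_of_nat: "riemann_zeta (of_nat k) = (\<Sum>n. 1 / of_nat (Suc n) ^ k)"
  unfolding riemann_zeta_def by (subst powr_nat') (auto simp del: of_nat_Suc)

lemma ln_one_minus_sums:
  fixes x :: complex
  assumes "norm x < 1"
  shows "(\<lambda>j. x ^ Suc j / of_nat (Suc j)) sums (- ln (1 - x))"
proof -
  have "(\<lambda>n. - (x ^ n) / of_nat n) sums ln (1 - x)"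
    using Ln_series'[of "-x"] assms by simp
  from sums_minus[OF this] have "(\<lambda>n. x ^ n / of_nat n) sums (- ln (1 - x))"
    by simp
  thus ?thesis
    \<comment> \<open>The shift loses nothing: the term of index 0 is
      \<open>x ^ 0 / 0 = 0\<close>.\<close>
    by (subst sums_Suc_iff) simp
qed

text \<open>Truncating every zeta value to its first \<open>N\<close> terms turns the exponent into
  a finite sum of logarithm series, whose exponential is the Euler product. Tannery's theorem, now
  over \<open>j\<close>, gives the limit in \<open>N\<close>.\<close>

lemma zeta_exponential_LIMSEQ:
  fixes z :: complex
  assumes "m \<ge> 2" "norm z < pi"
  shows "summable (zeta_exponent_term m z)"
    and "(\<lambda>N. \<Prod>n=1..N. 1 / (1 - (z / of_real pi / of_nat n) ^ m)) \<longlonglongrightarrow> zeta_exponential m z"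
proof -
  define u where "u = z / of_real pi"
  have u: "norm u < 1"
    using assms by (simp add: u_def norm_divide)
  hence um: "norm u ^ m < 1"
    using assms by (simp add: power_less_one_iff)
  define a where "a = (\<lambda>j N. (\<Sum>n<N. 1 / of_nat (Suc n) ^ (m * Suc j)) / of_nat (Suc j) * u ^ (m * Suc j))"
  \<comment> \<open>This is zeta(2), which dominates all the truncated zeta sums because every
    exponent \<open>m * Suc j\<close> is at least 2.\<close>
  define S :: real where "S = (\<Sum>n. 1 / real (Suc n) ^ 2)"
  have summable_2: "summable (\<lambda>n. 1 / real (Suc n) ^ 2)"
    using inverse_power_summable[of 2, where 'a = real]
    by (subst summable_Suc_iff[of "\<lambda>n. 1 / real n ^ 2"]) (simp add: field_simps)
  have term_le: "norm (1 / of_nat (Suc n) ^ (m * Suc j) :: complex) \<le> 1 / real (Suc n) ^ 2" for n j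
  proof -
    have "2 \<le> m * Suc j"
      using assms(1) by (simp add: trans_le_add1)
    hence "real (Suc n) ^ 2 \<le> real (Suc n) ^ (m * Suc j)"
      by (intro power_increasing) auto
    thus ?thesis
      unfolding norm_divide norm_power norm_of_nat norm_one
      by (intro divide_left_mono) auto
  qed
  have S_le: "norm (\<Sum>n<N. 1 / of_nat (Suc n) ^ (m * Suc j) :: complex) \<le> S" for N j
  proof -
    have "norm (\<Sum>n<N. 1 / of_nat (Suc n) ^ (m * Suc j) :: complex) \<le> (\<Sum>n<N. 1 / real (Suc n) ^ 2)"
      by (rule sum_norm_le) (rule term_le)
    also have "\<dots> \<le> S"
      unfolding S_def using summable_2 by (intro sum_le_suminf) auto
    finally show ?thesis .
  qed
  have M: "summable (\<lambda>j. S * (norm u ^ m) ^ Suc j)"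
    using um by (intro summable_mult) (simp add: summable_geometric summable_Suc_iff del: power_Suc)
  have T: "(\<forall>\<^sub>F N in sequentially. summable (\<lambda>j. norm (a j N))) \<and>
      summable (\<lambda>j. norm (zeta_exponent_term m z j)) \<and>
      (\<lambda>N. \<Sum>j. a j N) \<longlonglongrightarrow> (\<Sum>j. zeta_exponent_term m z j)"
  proof (rule tannerys_theorem[OF _ _ M])
    fix j
    have "summable (\<lambda>n. 1 / of_nat (Suc n) ^ (m * Suc j) :: complex)"
      by (rule summable_comparison_test[OF _ summable_2]) (use term_le in blast)
    hence "(\<lambda>N. \<Sum>n<N. 1 / of_nat (Suc n) ^ (m * Suc j)) \<longlonglongrightarrow> riemann_zeta (of_nat (m * Suc j))"
      unfolding riemann_zeta_of_nat by (rule summable_LIMSEQ)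
    thus "a j \<longlonglongrightarrow> zeta_exponent_term m z j"
      unfolding a_def zeta_exponent_term_def u_def
      by (intro tendsto_intros) (simp_all del: of_nat_Suc)
  next
    have "norm (a j N) \<le> S * (norm u ^ m) ^ Suc j" for j N
    proof -
      have "norm (a j N) = norm (\<Sum>n<N. 1 / of_nat (Suc n) ^ (m * Suc j) :: complex) / real (Suc j) *
          (norm u ^ m) ^ Suc j"
        unfolding a_def norm_mult norm_divide norm_power norm_of_nat power_mult ..
      also have "\<dots> \<le> S / 1 * (norm u ^ m) ^ Suc j"
        using order_trans[OF norm_ge_zero S_le]
        by (intro mult_right_mono frac_le S_le) auto
      finally show ?thesis
        by simp
    qed
    thus "\<forall>\<^sub>F (j, N) in sequentially \<times>\<^sub>F sequentially. norm (a j N) \<le> S * (norm u ^ m) ^ Suc j"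
      by (intro always_eventually) auto
  qed simp
  thus "summable (zeta_exponent_term m z)"
    using summable_norm_cancel by blast
  have "exp (\<Sum>j. a j N) = (\<Prod>n=1..N. 1 / (1 - (z / of_real pi / of_nat n) ^ m))" for N
  proof -
    define x where "x = (\<lambda>n. (u / of_nat (Suc n)) ^ m)"
    have x: "norm (x n) < 1" for n
    proof -
      have "norm (u / of_nat (Suc n)) \<le> norm u / 1"
        unfolding norm_divide norm_of_nat by (intro divide_left_mono) auto
      thus ?thesis
        unfolding x_def norm_power using u assms(1) by (simp add: power_less_one_iff del: of_nat_Suc)
    qed
    have "(\<lambda>j. \<Sum>n<N. x n ^ Suc j / of_nat (Suc j)) sums (\<Sum>n<N. - ln (1 - x n))"
      by (intro sums_sum ln_one_minus_sums x)
    also have "(\<lambda>j. \<Sum>n<N. x n ^ Suc j / of_nat (Suc j)) = (\<lambda>j. a j N)"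
      unfolding a_def x_def power_mult[symmetric] power_divide sum_divide_distrib sum_distrib_right
      by (simp add: mult_ac)
    \<comment> \<open>Exponentiating removes any question of branches: the logarithms are only
      added, never combined into one.\<close>
    finally have "exp (\<Sum>j. a j N) = exp (\<Sum>n<N. - ln (1 - x n))"
      by (simp add: sums_iff)
    also have "\<dots> = (\<Prod>n<N. 1 / (1 - x n))"
    proof -
      have "1 - x n \<noteq> 0" for n
        using x[of n] by auto
      thus ?thesis
        by (simp add: exp_sum exp_minus field_simps)
    qed
    finally show ?thesis
      by (simp add: prod.atLeast1_atMost_eq x_def u_def)
  qed
  moreover have "(\<lambda>N. exp (\<Sum>j. a j N)) \<longlonglongrightarrow> zeta_exponential m z"
    unfolding zeta_exponential_def using T by (intro tendsto_exp) blast
  ultimately show "(\<lambda>N. \<Prod>n=1..N. 1 / (1 - (z / of_real pi / of_nat n) ^ m)) \<longlonglongrightarrow> zeta_exponential m z"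
    by simp
qed

section \<open>Comparison of the Taylor coefficients at 0\<close>

theorem theorem5p7:
  fixes m k :: nat
  assumes "m \<ge> 2"
  shows "partition_zeta_term m summable_on partitions_with_parts k \<and>
    gamma_product m analytic_on {0} \<and>
    (\<forall>\<^sub>F z in nhds 0. summable (zeta_exponent_term m z)) \<and>
    zeta_exponential m analytic_on {0} \<and>
    of_real (partition_zeta m k) =
      of_real pi ^ (m * k) * taylor_coeff (m * k) (gamma_product m) \<and>
    of_real pi ^ (m * k) * taylor_coeff (m * k) (gamma_product m) =
      of_real pi ^ (m * k) * taylor_coeff (m * k) (zeta_exponential m)"
proof -
  define F :: "complex fps" where "F = Abs_fps
    (\<lambda>n. if m dvd n then of_real (partition_zeta m (n div m)) / of_real pi ^ n else 0)"
  have near_0: "\<forall>\<^sub>F z in nhds 0. z \<in> ball (0 :: complex) pi"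
    by (intro eventually_nhds_in_open) auto
  have gamma: "gamma_product m has_fps_expansion F"
    unfolding F_def using assms by (rule gamma_product_has_fps_expansion)
  \<comment> \<open>Both functions are limits of the same Euler products on the disc of radius
    \<open>pi\<close>, so they share the expansion \<open>F\<close>.\<close>
  have "\<forall>\<^sub>F z in nhds 0. gamma_product m z = zeta_exponential m z"
    using near_0
  proof eventually_elim
    case (elim z)
    thus ?case
      using LIMSEQ_unique[OF gamma_product_LIMSEQ zeta_exponential_LIMSEQ(2)] assms by simp
  qed
  hence zeta: "zeta_exponential m has_fps_expansion F"
    using gamma has_fps_expansion_cong by blast
  have "\<forall>\<^sub>F z in nhds 0. summable (zeta_exponent_term m z)"
    using near_0 by eventually_elim (use assms in \<open>auto intro: zeta_exponential_LIMSEQ(1)\<close>)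
  moreover have "of_real pi ^ (m * k) * fps_nth F (m * k) = of_real (partition_zeta m k)"
    using assms by (simp add: F_def)
  ultimately show ?thesis
    using gamma zeta summable_on_partition_zeta_term[OF assms]
    by (simp add: taylor_coeff_has_fps_expansion has_fps_expansion_imp_analytic_0)
qed

end
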